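(* Let $S$ be a finite non-empty set, let $b$ be an integer-valued submodular set-function on $S$ (values $+\infty$ allowed, $-\infty$ not) with $b(\emptyset)=0$ and $b(S)$ finite, and let $p$ be its complementary function, $p(X)=b(S)-b(S-X)$. Let $B=\{x\in\mathbb{R}^S:\widetilde x(S)=b(S),\ \widetilde x(Z)\le b(Z)\ \forall Z\subseteq S\}$ (equivalently $B=\{x:\widetilde x(S)=p(S),\ \widetilde x(Z)\ge p(Z)\ \forall Z\subseteq S\}$). For an integral element $m\in B\cap\mathbb{Z}^S$ the following four conditions are pairwise equivalent: (A) there are no elements $s,t\in S$ with $m(t)\ge m(s)+2$ such that $m+\chi_s-\chi_t\in B$; (B) there is a chain $\emptyset\subset C_1\subset C_2\subset\cdots\subset C_\ell=S$ of $m$-top sets, each of which is $m$-tight with respect to $p$ (i.e. $\widetilde m(C_i)=p(C_i)$), such that for every $i$ the restriction of $m$ to $S_i:=C_i-C_{i-1}$ (with $C_0=\emptyset$) is near-uniform; (C1) $m$ is decreasingly minimal in $B\cap\mathbb{Z}^S$; (C2) $m$ is increasingly maximal in $B\cap\mathbb{Z}^S$.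
   Context: For $x\in\mathbb{R}^S$ and $X\subseteq S$, $\widetilde x(X)=\sum_{s\in X}x(s)$; $\chi_Z$ is the characteristic vector of $Z$. A set $X\subseteq S$ is an $m$-top set if $m(u)\ge m(v)$ whenever $u\in X$, $v\in S-X$. An integral vector is near-uniform if its largest and smallest components differ by at most 1. For a vector $x$, $x{\downarrow}$ ($x{\uparrow}$) is the vector obtained by rearranging its components in decreasing (increasing) order. An element $m$ of a set $Q$ of vectors is decreasingly minimal (dec-min) if $m{\downarrow}$ is lexicographically smaller than or equal to $y{\downarrow}$ for every $y\in Q$, and increasingly maximal (inc-max) if $m{\uparrow}$ is lexicographically larger than or equal to $y{\uparrow}$ for every $y\in Q$. *)

theory Defs
  imports
    "HOL-Library.Extended_Real"
    "HOL-Library.Multiset"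
    "HOL-Library.FuncSet"
    "HOL-Library.Indicator_Function"
    "HOL-Library.List_Lexorder"
begin

text \<open>
  Vectors over a finite ground set \<open>S\<close>: elements of \<open>\<real>\<^sup>S\<close> are the functions of type
  \<^typ>\<open>'a \<Rightarrow> real\<close> that are extensional on \<open>S\<close>.
\<close>

definition real_vecs :: "'a set \<Rightarrow> ('a \<Rightarrow> real) set" where
  "real_vecs S = S \<rightarrow>\<^sub>E UNIV"

definition int_vecs :: "'a set \<Rightarrow> ('a \<Rightarrow> real) set" where
  "int_vecs S = S \<rightarrow>\<^sub>E \<int>"

definition int_valued :: "'a set \<Rightarrow> ('a set \<Rightarrow> ereal) \<Rightarrow> bool" where
  "int_valued S b \<longleftrightarrow> (\<forall>X\<subseteq>S. b X = \<infinity> \<or> (\<exists>k::int. b X = ereal (real_of_int k)))"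

definition submodular :: "'a set \<Rightarrow> ('a set \<Rightarrow> ereal) \<Rightarrow> bool" where
  "submodular S b \<longleftrightarrow> (\<forall>X\<subseteq>S. \<forall>Y\<subseteq>S. b X + b Y \<ge> b (X \<inter> Y) + b (X \<union> Y))"

definition complementary :: "'a set \<Rightarrow> ('a set \<Rightarrow> ereal) \<Rightarrow> 'a set \<Rightarrow> ereal" where
  "complementary S b X = b S - b (S - X)"

definition base_polyhedron :: "'a set \<Rightarrow> ('a set \<Rightarrow> ereal) \<Rightarrow> ('a \<Rightarrow> real) set" where
  "base_polyhedron S b =
     {x \<in> real_vecs S. ereal (sum x S) = b S \<and> (\<forall>Z\<subseteq>S. ereal (sum x Z) \<le> b Z)}"

lemma base_polyhedron_complementary:
  assumes "finite S" and "b {} = 0" and "\<bar>b S\<bar> \<noteq> \<infinity>"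
  shows "base_polyhedron S b =
    {x \<in> real_vecs S. ereal (sum x S) = complementary S b S \<and>
       (\<forall>Z\<subseteq>S. ereal (sum x Z) \<ge> complementary S b Z)}"
proof -
  have pS: "complementary S b S = b S"
    using assms by (simp add: complementary_def)
  have key: "complementary S b Z \<le> ereal (sum x Z) \<longleftrightarrow> ereal (sum x (S - Z)) \<le> b (S - Z)"
    if "ereal (sum x S) = b S" "Z \<subseteq> S" for x Z
  proof -
    have "sum x S = sum x (S - Z) + sum x Z"
      using sum.subset_diff[OF that(2) assms(1)] .
    then show ?thesis
      unfolding complementary_def that(1)[symmetric]
      by (cases "b (S - Z)") auto
  qed
  have "(\<forall>Z\<subseteq>S. ereal (sum x Z) \<le> b Z) \<longleftrightarrow> (\<forall>Z\<subseteq>S. complementary S b Z \<le> ereal (sum x Z))"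
    if "ereal (sum x S) = b S" for x
    using key[OF that] by (metis Diff_subset double_diff subset_refl)
  then show ?thesis
    unfolding base_polyhedron_def pS by blast
qed

definition top_set :: "'a set \<Rightarrow> ('a \<Rightarrow> real) \<Rightarrow> 'a set \<Rightarrow> bool" where
  "top_set S m X \<longleftrightarrow> X \<subseteq> S \<and> (\<forall>u\<in>X. \<forall>v\<in>S - X. m u \<ge> m v)"

definition tight :: "('a set \<Rightarrow> ereal) \<Rightarrow> ('a \<Rightarrow> real) \<Rightarrow> 'a set \<Rightarrow> bool" where
  "tight p m X \<longleftrightarrow> ereal (sum m X) = p X"

definition near_uniform :: "'a set \<Rightarrow> ('a \<Rightarrow> real) \<Rightarrow> bool" where
  "near_uniform T x \<longleftrightarrow> x \<in> int_vecs T \<and> Max (x ` T) - Min (x ` T) \<le> 1"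

definition incr_sort :: "'a set \<Rightarrow> ('a \<Rightarrow> real) \<Rightarrow> real list" where
  "incr_sort S x = sorted_list_of_multiset (image_mset x (mset_set S))"

definition decr_sort :: "'a set \<Rightarrow> ('a \<Rightarrow> real) \<Rightarrow> real list" where
  "decr_sort S x = rev (incr_sort S x)"

text \<open>The order on lists below is the lexicographic one of \<^theory>\<open>HOL-Library.List_Lexorder\<close>.\<close>

definition dec_min :: "'a set \<Rightarrow> ('a \<Rightarrow> real) set \<Rightarrow> ('a \<Rightarrow> real) \<Rightarrow> bool" where
  "dec_min S Q m \<longleftrightarrow> m \<in> Q \<and> (\<forall>y\<in>Q. decr_sort S m \<le> decr_sort S y)"

definition inc_max :: "'a set \<Rightarrow> ('a \<Rightarrow> real) set \<Rightarrow> ('a \<Rightarrow> real) \<Rightarrow> bool" where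
  "inc_max S Q m \<longleftrightarrow> m \<in> Q \<and> (\<forall>y\<in>Q. incr_sort S m \<ge> incr_sort S y)"

definition no_tightening_step :: "'a set \<Rightarrow> ('a \<Rightarrow> real) set \<Rightarrow> ('a \<Rightarrow> real) \<Rightarrow> bool" where
  "no_tightening_step S B m \<longleftrightarrow>
     \<not> (\<exists>s\<in>S. \<exists>t\<in>S. m t \<ge> m s + 2 \<and> (\<lambda>v\<in>S. m v + indicator {s} v - indicator {t} v) \<in> B)"

definition has_tight_top_chain :: "'a set \<Rightarrow> ('a set \<Rightarrow> ereal) \<Rightarrow> ('a \<Rightarrow> real) \<Rightarrow> bool" where
  "has_tight_top_chain S p m \<longleftrightarrow>
     (\<exists>(l::nat) C. C 0 = {} \<and> C l = S \<and>
        (\<forall>i\<in>{1..l}. C (i - 1) \<subset> C i \<and> top_set S m (C i) \<and> tight p m (C i) \<and>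
           near_uniform (C i - C (i - 1)) (restrict m (C i - C (i - 1)))))"

end

theory Submission
  imports Defs
begin

text \<open>
  A tight top chain yields, for every integer \<open>k\<close>, a tight set \<open>X\<close> with \<open>m \<ge> k\<close> on \<open>X\<close> and
  \<open>m \<le> k\<close> off \<open>X\<close>. Hence \<open>\<Sum>(m - k)\<^sup>+ = m(X) - k|X| = p(X) - k|X| \<le> y(X) - k|X| \<le> \<Sum>(y - k)\<^sup>+\<close> for
  every \<open>y\<close> in the base polyhedron, and this majorization, compared at the extreme value on which
  the value counts of \<open>m\<close> and \<open>y\<close> differ, gives both lexicographic optimality properties. A
  tightening step strictly improves both sorted vectors, so each of them excludes such steps.

  If no tightening step exists, integrality gives for \<open>m t \<ge> m s + 2\<close> a tight set containing \<open>t\<close>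
  but not \<open>s\<close>. Tight sets form a lattice, so there are tight sets \<open>X t\<close> containing \<open>t\<close> on which
  \<open>m \<ge> m t - 1\<close>. The unions of the \<open>X t\<close> over \<open>m t \<ge> k\<close>, for decreasing \<open>k\<close>, form the chain.
\<close>

section \<open>Lexicographic comparison of sorted multisets\<close>

lemma mset_split_at:
  fixes a :: "'a :: linorder"
  shows "M = {#x \<in># M. x < a#} + replicate_mset (count M a) a + {#x \<in># M. a < x#}"
  by (rule multiset_eqI) auto

lemma sorted_list_of_multiset_split_at:
  fixes a :: "'a :: linorder"
  shows "sorted_list_of_multiset M = sorted_list_of_multiset {#x \<in># M. x < a#}
           @ replicate (count M a) a @ sorted_list_of_multiset {#x \<in># M. a < x#}"
    (is "_ = ?R")
proof -
  have "mset ?R = M"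
    by (subst (4) mset_split_at[of M a]) (simp add: ac_simps)
  moreover have "sorted ?R"
    by (auto simp: sorted_append intro: less_imp_le order.strict_trans less_trans)
  ultimately show ?thesis
    by (metis sorted_list_of_multiset_mset sorted_sort_id)
qed

text \<open>Read from the largest entry down, both lists agree on the entries above \<open>a\<close>
  and on \<open>count M a\<close> copies of \<open>a\<close>. Then \<open>N\<close> shows one more
  \<open>a\<close>, while \<open>M\<close> goes on with something smaller or ends; ending also
  counts as smaller.\<close>

lemma rev_sorted_list_of_multiset_less:
  fixes a :: "'a :: linorder"
  assumes "count M a < count N a" and "\<And>c. c > a \<Longrightarrow> count M c = count N c"
  shows "rev (sorted_list_of_multiset M) < rev (sorted_list_of_multiset N)"
proof -
  obtain j where j: "count N a = count M a + Suc j"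
    using less_imp_Suc_add[OF assms(1)] by auto
  have up: "{#x \<in># M. a < x#} = {#x \<in># N. a < x#}"
    by (rule multiset_eqI) (auto simp: assms(2))
  define L where "L = rev (sorted_list_of_multiset {#x \<in># M. x < a#})"
  define R where "R = replicate j a @ rev (sorted_list_of_multiset {#x \<in># N. x < a#})"
  have "set L \<subseteq> {..<a}"
    by (auto simp: L_def)
  then have "L < a # R"
    by (cases L) auto
  then have "P @ replicate (count M a) a @ L < P @ replicate (count M a) a @ a # R" for P
    by (simp add: list_less_def lexord_append_leftI)
  moreover have "rev (sorted_list_of_multiset M)
      = rev (sorted_list_of_multiset {#x \<in># M. a < x#}) @ replicate (count M a) a @ L"
    by (subst sorted_list_of_multiset_split_at[of M a]) (simp add: L_def)
  moreover have "rev (sorted_list_of_multiset N)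
      = rev (sorted_list_of_multiset {#x \<in># M. a < x#}) @ replicate (count M a) a @ a # R"
    by (subst sorted_list_of_multiset_split_at[of N a])
      (simp only: rev_append rev_replicate,
        simp only: R_def j up replicate_add replicate_Suc append_assoc append_Cons)
  ultimately show ?thesis by simp
qed

text \<open>After the common prefix \<open>N\<close> continues with \<open>a\<close>. Equal sizes
  guarantee that the list of \<open>M\<close> does not end there, where it would be the smaller one,
  but continues with an entry above \<open>a\<close>.\<close>

lemma sorted_list_of_multiset_less:
  fixes a :: "'a :: linorder"
  assumes "size M = size N"
    and "count M a < count N a" and "\<And>c. c < a \<Longrightarrow> count M c = count N c"
  shows "sorted_list_of_multiset N < sorted_list_of_multiset M"
proof -
  obtain j where j: "count N a = count M a + Suc j"
    using less_imp_Suc_add[OF assms(2)] by auto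
  have low: "{#x \<in># M. x < a#} = {#x \<in># N. x < a#}"
    by (rule multiset_eqI) (auto simp: assms(3))
  define L where "L = sorted_list_of_multiset {#x \<in># M. a < x#}"
  define R where "R = replicate j a @ sorted_list_of_multiset {#x \<in># N. a < x#}"
  have "size {#x \<in># M. a < x#} > 0"
    using assms(1) arg_cong[OF mset_split_at[of M a], of size]
      arg_cong[OF mset_split_at[of N a], of size]
    by (simp add: low j)
  then have "L \<noteq> []"
    by (metis L_def mset.simps(1) mset_sorted_list_of_multiset size_empty less_irrefl)
  moreover have "set L \<subseteq> {a<..}"
    by (auto simp: L_def)
  ultimately have "a # R < L"
    by (cases L) auto
  then have "P @ replicate (count M a) a @ a # R < P @ replicate (count M a) a @ L" for P
    by (simp add: list_less_def lexord_append_leftI)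
  moreover have "sorted_list_of_multiset M
      = sorted_list_of_multiset {#x \<in># M. x < a#} @ replicate (count M a) a @ L"
    by (subst sorted_list_of_multiset_split_at[of M a]) (simp add: L_def)
  moreover have "sorted_list_of_multiset N
      = sorted_list_of_multiset {#x \<in># M. x < a#} @ replicate (count M a) a @ a # R"
    by (subst sorted_list_of_multiset_split_at[of N a])
      (simp only: R_def j low replicate_add replicate_Suc append_assoc append_Cons)
  ultimately show ?thesis by simp
qed

section \<open>Integral majorization\<close>

lemma Ints_less_imp_le_diff_one:
  fixes x y :: real
  assumes "x \<in> \<int>" and "y \<in> \<int>" and "x < y"
  shows "x \<le> y - 1"
  using assms by (auto elim!: Ints_cases)

text \<open>For integral entries the threshold \<open>a - 1\<close> isolates the multiplicity of
  \<open>a\<close>: entries below \<open>a\<close> contribute 0 and each copy of \<open>a\<close>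
  contributes exactly 1.\<close>

lemma sum_excess_split:
  fixes M :: "real multiset"
  assumes "set_mset M \<subseteq> \<int>" and "a \<in> \<int>"
  shows "(\<Sum>x\<in>#M. max 0 (x - (a - 1))) =
    real (count M a) + (\<Sum>x\<in>#{#x \<in># M. a < x#}. max 0 (x - (a - 1)))"
proof -
  have "max 0 (x - (a - 1)) = 0" if "x \<in># M" "x < a" for x
  proof -
    have "x \<in> \<int>"
      using that assms by auto
    with assms(2) that(2) have "x \<le> a - 1"
      by (intro Ints_less_imp_le_diff_one)
    then show ?thesis by simp
  qed
  then have "(\<Sum>x\<in>#{#x \<in># M. x < a#}. max 0 (x - (a - 1))) = 0"
    by (intro sum_mset.neutral) auto
  then show ?thesis
    by (subst mset_split_at[of M a]) simp
qed

text \<open>At the largest value \<open>a\<close> where the counts differ, the parts above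
  \<open>a\<close> coincide, so the excess sums for threshold \<open>a - 1\<close> differ only by
  the multiplicities of \<open>a\<close>.\<close>

lemma top_count_less_of_majorized:
  fixes M N :: "real multiset"
  assumes "set_mset M \<subseteq> \<int>" and "set_mset N \<subseteq> \<int>"
    and maj: "\<And>k. k \<in> \<int> \<Longrightarrow> (\<Sum>x\<in>#M. max 0 (x - k)) \<le> (\<Sum>x\<in>#N. max 0 (x - k))"
  shows "M = N \<or> (\<exists>a. count M a < count N a \<and> (\<forall>c>a. count M c = count N c))"
proof (cases "M = N")
  case False
  define D where "D = {c. count M c \<noteq> count N c}"
  have D: "D \<subseteq> set_mset M \<union> set_mset N"
    by (auto simp: D_def) (metis count_eq_zero_iff)
  then have fin: "finite D"
    using finite_subset by blast
  have "D \<noteq> {}"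
    using False by (auto simp: D_def intro: multiset_eqI)
  define a where "a = Max D"
  have aD: "a \<in> D"
    unfolding a_def using fin \<open>D \<noteq> {}\<close> by (rule Max_in)
  have above: "count M c = count N c" if "c > a" for c
    using Max_ge[OF fin, of c] that by (auto simp: a_def D_def)
  have up: "{#x \<in># M. a < x#} = {#x \<in># N. a < x#}"
    by (rule multiset_eqI) (auto simp: above)
  have "a \<in> \<int>"
    using aD D assms by blast
  then have "count M a \<le> count N a"
    using maj[of "a - 1"] by (simp add: sum_excess_split assms up)
  then show ?thesis
    using aD above by (auto simp: D_def intro!: exI[of _ a])
qed simp

lemma decr_sort_le_of_majorized:
  fixes m y :: "'a \<Rightarrow> real"
  assumes "finite S" and "m ` S \<subseteq> \<int>" and "y ` S \<subseteq> \<int>"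
    and "\<And>k. k \<in> \<int> \<Longrightarrow> (\<Sum>v\<in>S. max 0 (m v - k)) \<le> (\<Sum>v\<in>S. max 0 (y v - k))"
  shows "decr_sort S m \<le> decr_sort S y"
proof -
  let ?M = "image_mset m (mset_set S)" and ?N = "image_mset y (mset_set S)"
  have "?M = ?N \<or> (\<exists>a. count ?M a < count ?N a \<and> (\<forall>c>a. count ?M c = count ?N c))"
    by (rule top_count_less_of_majorized)
      (use assms in \<open>auto simp: sum_unfold_sum_mset multiset.map_comp o_def\<close>)
  then show ?thesis
    unfolding decr_sort_def incr_sort_def
    using rev_sorted_list_of_multiset_less[of ?M _ ?N] by (metis less_imp_le order_refl)
qed

lemma count_image_mset_uminus:
  fixes M :: "'a :: group_add multiset"
  shows "count (image_mset uminus M) c = count M (- c)"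
  by (induction M) (auto simp: minus_equation_iff)

text \<open>Negation turns shortfalls into excesses, so the largest difference of the negated
  multisets marks the smallest value on which \<open>m\<close> and \<open>y\<close> differ, and
  \<open>m\<close> takes that value less often.\<close>

lemma incr_sort_ge_of_majorized:
  fixes m y :: "'a \<Rightarrow> real"
  assumes "finite S" and "m ` S \<subseteq> \<int>" and "y ` S \<subseteq> \<int>"
    and maj: "\<And>k. k \<in> \<int> \<Longrightarrow> (\<Sum>v\<in>S. max 0 (k - m v)) \<le> (\<Sum>v\<in>S. max 0 (k - y v))"
  shows "incr_sort S y \<le> incr_sort S m"
proof -
  let ?M = "image_mset m (mset_set S)" and ?N = "image_mset y (mset_set S)"
  have "image_mset uminus ?M = image_mset uminus ?N \<or>
    (\<exists>a. count (image_mset uminus ?M) a < count (image_mset uminus ?N) a \<and>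
      (\<forall>c>a. count (image_mset uminus ?M) c = count (image_mset uminus ?N) c))"
  proof (rule top_count_less_of_majorized)
    fix k :: real
    assume "k \<in> \<int>"
    then show "(\<Sum>x\<in>#image_mset uminus ?M. max 0 (x - k))
        \<le> (\<Sum>x\<in>#image_mset uminus ?N. max 0 (x - k))"
      using maj[of "- k"]
      by (simp add: sum_unfold_sum_mset multiset.map_comp o_def minus_diff_commute)
  qed (use assms in auto)
  then show ?thesis
  proof (elim disjE exE conjE)
    assume "image_mset uminus ?M = image_mset uminus ?N"
    from arg_cong[OF this, of "image_mset uminus"] have "?M = ?N"
      by (simp add: multiset.map_comp o_def)
    then show ?thesis by (simp add: incr_sort_def)
  next
    fix a
    assume less: "count (image_mset uminus ?M) a < count (image_mset uminus ?N) a"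
      and above: "\<forall>c>a. count (image_mset uminus ?M) c = count (image_mset uminus ?N) c"
    have "sorted_list_of_multiset ?N < sorted_list_of_multiset ?M"
    proof (rule sorted_list_of_multiset_less)
      show "count ?M (- a) < count ?N (- a)"
        using less by (simp only: count_image_mset_uminus)
      show "count ?M c = count ?N c" if "c < - a" for c
        using above[rule_format, of "- c"] that
        by (simp only: count_image_mset_uminus minus_minus less_minus_iff)
    qed simp
    then show ?thesis by (simp add: incr_sort_def)
  qed
qed

section \<open>Tightening steps\<close>

text \<open>The values \<open>m s\<close> and \<open>m t\<close> become \<open>m s + 1\<close> and
  \<open>m t - 1\<close>. Because of the gap of 2 both stay strictly between the old ones, so
  \<open>m t\<close> loses a copy with nothing changed above it, and \<open>m s\<close> loses a copy
  with nothing changed below it.\<close>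

lemma tightening_step_sorts:
  fixes m :: "'a \<Rightarrow> real"
  assumes "finite S" and "s \<in> S" and "t \<in> S" and "m t \<ge> m s + 2"
  defines "y \<equiv> (\<lambda>v\<in>S. m v + indicator {s} v - indicator {t} v)"
  shows "decr_sort S y < decr_sort S m" and "incr_sort S m < incr_sort S y"
proof -
  have st: "s \<noteq> t"
    using assms(4) by auto
  define R where "R = image_mset m (mset_set (S - {s, t}))"
  have S: "mset_set S = {#s, t#} + mset_set (S - {s, t})"
  proof -
    have "S = insert s (insert t (S - {s, t}))"
      using assms by blast
    then have "mset_set S = mset_set (insert s (insert t (S - {s, t})))"
      by (rule arg_cong)
    also have "\<dots> = {#s, t#} + mset_set (S - {s, t})"
      using st \<open>finite S\<close> by (subst mset_set.insert) auto
    finally show ?thesis .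
  qed
  have M: "image_mset m (mset_set S) = {#m s, m t#} + R"
    by (simp add: S R_def)
  have "image_mset y (mset_set (S - {s, t})) = R"
    unfolding R_def using \<open>finite S\<close> by (intro image_mset_cong) (auto simp: y_def)
  then have Y: "image_mset y (mset_set S) = {#m s + 1, m t - 1#} + R"
    using st assms(2,3) by (simp add: S y_def)
  show "decr_sort S y < decr_sort S m"
    unfolding decr_sort_def incr_sort_def M Y
    by (rule rev_sorted_list_of_multiset_less[where a = "m t"]) (use assms(4) in auto)
  show "incr_sort S m < incr_sort S y"
    unfolding incr_sort_def M Y
    by (rule sorted_list_of_multiset_less[where a = "m s"]) (use assms(4) in auto)
qed

section \<open>From a tight chain to majorization\<close>

lemma near_uniform_restrict_iff:
  assumes "finite T" and "T \<noteq> {}"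
  shows "near_uniform T (restrict m T) \<longleftrightarrow>
    m ` T \<subseteq> \<int> \<and> (\<forall>u\<in>T. \<forall>v\<in>T. m u - m v \<le> 1)"
proof -
  have "Max (m ` T) - Min (m ` T) \<le> 1 \<longleftrightarrow> (\<forall>u\<in>T. \<forall>v\<in>T. m u - m v \<le> 1)"
  proof
    assume L: "Max (m ` T) - Min (m ` T) \<le> 1"
    show "\<forall>u\<in>T. \<forall>v\<in>T. m u - m v \<le> 1"
    proof (intro ballI)
      fix u v assume "u \<in> T" "v \<in> T"
      then have "m u \<le> Max (m ` T)" "Min (m ` T) \<le> m v"
        using assms by auto
      with L show "m u - m v \<le> 1" by linarith
    qed
  next
    assume R: "\<forall>u\<in>T. \<forall>v\<in>T. m u - m v \<le> 1"
    have "Max (m ` T) \<in> m ` T" "Min (m ` T) \<in> m ` T"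
      using assms by simp_all
    with R show "Max (m ` T) - Min (m ` T) \<le> 1" by auto
  qed
  then show ?thesis
    by (auto simp: near_uniform_def int_vecs_def)
qed

text \<open>\<open>X\<close> is the last chain member with all values at least \<open>k\<close>. The
  next member has an element \<open>w\<close> of value at most \<open>k - 1\<close>; near-uniformity
  bounds the rest of that block by \<open>k\<close>, and the top-set property bounds everything
  beyond it by \<open>m w\<close>.\<close>

lemma tight_top_chain_threshold:
  fixes m :: "'a \<Rightarrow> real"
  assumes "finite S" and "m ` S \<subseteq> \<int>" and "k \<in> \<int>" and "has_tight_top_chain S p m"
    and "tight p m {}"
  obtains X where "X \<subseteq> S" and "tight p m X"
    and "\<And>v. v \<in> X \<Longrightarrow> k \<le> m v" and "\<And>v. v \<in> S - X \<Longrightarrow> m v \<le> k"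
proof -
  obtain l :: nat and C where C0: "C 0 = {}" and Cl: "C l = S" and
    step: "\<forall>i\<in>{1..l}. C (i - 1) \<subset> C i \<and> top_set S m (C i) \<and> tight p m (C i) \<and>
      near_uniform (C i - C (i - 1)) (restrict m (C i - C (i - 1)))"
    using assms(4) unfolding has_tight_top_chain_def by blast
  define J where "J = {j. j \<le> l \<and> (\<forall>v\<in>C j. k \<le> m v)}"
  have finJ: "finite J" and "0 \<in> J"
    by (auto simp: J_def C0)
  define j where "j = Max J"
  have "j \<in> J"
    unfolding j_def using finJ \<open>0 \<in> J\<close> by (intro Max_in) auto
  then have jl: "j \<le> l" and ge: "\<forall>v\<in>C j. k \<le> m v"
    by (auto simp: J_def)
  \<comment> \<open>The chain conditions start at index 1; the case \<open>j = 0\<close> rests on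
    tightness of the empty set.\<close>
  have tight_Cj: "C j \<subseteq> S \<and> tight p m (C j)"
  proof (cases "j = 0")
    case False
    then show ?thesis using step[rule_format, of j] jl by (auto simp: top_set_def)
  qed (simp add: C0 assms)
  have "m v \<le> k" if v: "v \<in> S - C j" for v
  proof -
    have "j < l"
      using v jl Cl by (cases "j = l") auto
    then have "Suc j \<notin> J"
      using Max_ge[OF finJ, of "Suc j"] by (auto simp: j_def)
    with \<open>j < l\<close> obtain w where w: "w \<in> C (Suc j)" "m w < k"
      by (auto simp: J_def not_le)
    have w': "w \<in> C (Suc j) - C j"
      using w ge by force
    have st: "C j \<subset> C (Suc j)" "top_set S m (C (Suc j))"
      "near_uniform (C (Suc j) - C j) (restrict m (C (Suc j) - C j))"
      using step[rule_format, of "Suc j"] \<open>j < l\<close> by auto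
    have sub: "C (Suc j) \<subseteq> S"
      using st by (simp add: top_set_def)
    have "m w \<in> \<int>"
      using w sub assms(2) by blast
    then have wk: "m w \<le> k - 1"
      using w(2) assms(3) by (intro Ints_less_imp_le_diff_one)
    show ?thesis
    proof (cases "v \<in> C (Suc j)")
      case True
      have "finite (C (Suc j) - C j)"
        using sub assms(1) by (meson finite_Diff finite_subset)
      then have "m v - m w \<le> 1"
        using st(3) near_uniform_restrict_iff[of "C (Suc j) - C j" m] w' True v by blast
      then show ?thesis using wk by simp
    next
      case False
      then have "m v \<le> m w"
        using st(2) v w by (auto simp: top_set_def)
      then show ?thesis using wk by simp
    qed
  qed
  then show ?thesis
    using that[of "C j"] tight_Cj ge by blast
qed

lemma tight_top_chain_majorizes:
  fixes m y :: "'a \<Rightarrow> real"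
  assumes "finite S" and "m ` S \<subseteq> \<int>" and "k \<in> \<int>" and "has_tight_top_chain S p m"
    and "tight p m {}" and y: "\<And>Z. Z \<subseteq> S \<Longrightarrow> p Z \<le> ereal (sum y Z)"
  shows "(\<Sum>v\<in>S. max 0 (m v - k)) \<le> (\<Sum>v\<in>S. max 0 (y v - k))"
proof -
  obtain X where X: "X \<subseteq> S" "tight p m X"
    "\<And>v. v \<in> X \<Longrightarrow> k \<le> m v" "\<And>v. v \<in> S - X \<Longrightarrow> m v \<le> k"
    using tight_top_chain_threshold[OF assms(1-5)] by metis
  have "(\<Sum>v\<in>S. max 0 (m v - k)) = (\<Sum>v\<in>X. m v - k)"
    using X by (intro sum.mono_neutral_cong_right assms(1)) auto
  also have "\<dots> \<le> (\<Sum>v\<in>X. y v - k)"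
    using y[OF X(1)] X(2)[unfolded tight_def, symmetric] by (simp add: sum_subtractf)
  also have "\<dots> \<le> (\<Sum>v\<in>X. max 0 (y v - k))"
    by (rule sum_mono) simp
  also have "\<dots> \<le> (\<Sum>v\<in>S. max 0 (y v - k))"
    using X(1) by (intro sum_mono2 assms(1)) auto
  finally show ?thesis .
qed

text \<open>For vectors of equal total this converts domination of excesses into domination of
  shortfalls, which is what increasing maximality requires.\<close>

lemma sum_shortfall_eq:
  fixes x :: "'a \<Rightarrow> real"
  shows "(\<Sum>v\<in>S. max 0 (k - x v)) = (\<Sum>v\<in>S. max 0 (x v - k)) - (\<Sum>v\<in>S. x v - k)"
proof -
  have "max 0 (k - x v) = max 0 (x v - k) - (x v - k)" for v
    by (simp add: max_def)
  then show ?thesis by (simp only: sum_subtractf)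
qed

section \<open>Tight sets of a submodular function\<close>

text \<open>Uncrossing: m(X) + m(Y) = b(X) + b(Y) is at least b(X Int Y) + b(X Un Y), which is at
  least m(X Int Y) + m(X Un Y). The two ends agree, so both bounds are attained.\<close>

lemma tight_Int_Un:
  assumes "finite S" and "submodular S b" and le: "\<And>Z. Z \<subseteq> S \<Longrightarrow> ereal (sum m Z) \<le> b Z"
    and "X \<subseteq> S" and "Y \<subseteq> S" and "tight b m X" and "tight b m Y"
  shows "tight b m (X \<inter> Y)" and "tight b m (X \<union> Y)"
proof -
  have "finite X" "finite Y"
    using assms finite_subset by blast+
  then have eq: "sum m (X \<union> Y) + sum m (X \<inter> Y) = sum m X + sum m Y"
    by (rule sum.union_inter)
  have sub: "b (X \<inter> Y) + b (X \<union> Y) \<le> b X + b Y"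
    using assms by (auto simp: submodular_def)
  have le1: "ereal (sum m (X \<inter> Y)) \<le> b (X \<inter> Y)" and le2: "ereal (sum m (X \<union> Y)) \<le> b (X \<union> Y)"
    using assms(4,5) by (auto intro!: le)
  have bXY: "b X = ereal (sum m X)" "b Y = ereal (sum m Y)"
    using assms(6,7) by (simp_all add: tight_def)
  show "tight b m (X \<inter> Y)" "tight b m (X \<union> Y)"
    using le1 le2 sub eq unfolding tight_def bXY
    \<comment> \<open>Infinite values are excluded: minus infinity by the lower bounds
      \<open>le1\<close> and \<open>le2\<close>, plus infinity by the finite right-hand side of
      \<open>sub\<close>.\<close>
    by (cases "b (X \<inter> Y)"; cases "b (X \<union> Y)"; simp)+
qed

lemma tight_complementary_iff:
  assumes "finite S" and "X \<subseteq> S" and "ereal (sum m S) = b S"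
  shows "tight (complementary S b) m X \<longleftrightarrow> tight b m (S - X)"
proof -
  have "sum m S = sum m (S - X) + sum m X"
    using assms by (intro sum.subset_diff)
  then show ?thesis
    unfolding tight_def complementary_def assms(3)[symmetric]
    by (cases "b (S - X)") auto
qed

text \<open>The step preserves the total, so it must violate the bound of some \<open>Z\<close>. It
  raises the sum over \<open>Z\<close> only if \<open>s\<close> enters the count and
  \<open>t\<close> does not, and then by 1; integrality leaves no slack before the step.\<close>

lemma blocked_step_tight:
  assumes "finite S" and "int_valued S b" and m: "m \<in> base_polyhedron S b \<inter> int_vecs S"
    and "s \<in> S" and "t \<in> S" and "s \<noteq> t"
    and blocked: "(\<lambda>v\<in>S. m v + indicator {s} v - indicator {t} v) \<notin> base_polyhedron S b"
  obtains Z where "Z \<subseteq> S" and "tight b m Z" and "s \<in> Z" and "t \<notin> Z"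
proof -
  define y where "y = (\<lambda>v\<in>S. m v + indicator {s} v - indicator {t} v :: real)"
  have sum_y: "sum y Z = sum m Z + indicator Z s - indicator Z t" if "Z \<subseteq> S" for Z
  proof -
    have "finite Z"
      using that assms(1) finite_subset by blast
    have "sum y Z = (\<Sum>v\<in>Z. m v + indicator {s} v - indicator {t} v)"
      using that by (intro sum.cong) (auto simp: y_def)
    also have "\<dots> = sum m Z + (\<Sum>v\<in>Z. indicator {s} v) - (\<Sum>v\<in>Z. indicator {t} v)"
      by (simp add: sum.distrib sum_subtractf)
    also have "(\<Sum>v\<in>Z. indicator {s} v :: real) = indicator Z s"
      using \<open>finite Z\<close> by (simp add: indicator_def sum.delta)
    also have "(\<Sum>v\<in>Z. indicator {t} v :: real) = indicator Z t"
      using \<open>finite Z\<close> by (simp add: indicator_def sum.delta)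
    finally show ?thesis .
  qed
  have "y \<in> real_vecs S"
    by (auto simp: y_def real_vecs_def)
  moreover have "ereal (sum y S) = b S"
    using m assms(4,5) by (simp add: sum_y base_polyhedron_def)
  ultimately obtain Z where Z: "Z \<subseteq> S" "\<not> ereal (sum y Z) \<le> b Z"
    using blocked unfolding base_polyhedron_def y_def by blast
  have le: "ereal (sum m Z) \<le> b Z"
    using m Z(1) by (auto simp: base_polyhedron_def)
  have "sum m Z < sum y Z"
    using le Z(2) by (metis ereal_less_eq(3) not_le order_trans less_imp_le)
  then have st: "s \<in> Z" "t \<notin> Z" and y1: "sum y Z = sum m Z + 1"
    using sum_y[OF Z(1)] by (auto simp: indicator_def split: if_splits)
  have "sum m Z \<in> \<int>"
    using m Z(1) by (intro Ints_sum) (auto simp: int_vecs_def)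
  then obtain i where i: "sum m Z = real_of_int i"
    by (auto elim: Ints_cases)
  \<comment> \<open>A violated bound cannot be infinite.\<close>
  obtain k where k: "b Z = ereal (real_of_int k)"
    using assms(2) Z by (auto simp: int_valued_def)
  have "tight b m Z"
    using le Z(2) unfolding y1 i k tight_def by simp
  then show ?thesis
    using that Z(1) st by blast
qed

section \<open>Construction of the chain\<close>

text \<open>Only equal neighbours are merged, so each surviving adjacent pair is one that
  \<open>Q\<close> already relates.\<close>

lemma strict_chain_of_weak_chain:
  fixes E :: "nat \<Rightarrow> 'a"
  assumes "\<And>i. i < n \<Longrightarrow> E i = E (Suc i) \<or> Q (E i) (E (Suc i))"
  shows "\<exists>(l::nat) C. C 0 = E 0 \<and> C l = E n \<and> (\<forall>i\<in>{1..l}. Q (C (i - 1)) (C i))"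
  using assms
proof (induction n)
  case 0
  show ?case by (rule exI[of _ 0], rule exI[of _ E]) simp
next
  case (Suc n)
  then obtain l :: nat and C where C: "C 0 = E 0" "C l = E n"
    "\<forall>i\<in>{1..l}. Q (C (i - 1)) (C i)"
    by force
  show ?case
  proof (cases "E n = E (Suc n)")
    case True
    then show ?thesis using C by auto
  next
    case False
    then have "Q (E n) (E (Suc n))"
      using Suc.prems by blast
    then show ?thesis
      using C by (intro exI[of _ "Suc l"] exI[of _ "C(Suc l := E (Suc n))"])
        (auto simp: le_Suc_eq)
  qed
qed

text \<open>\<open>D k\<close> lies between the level sets m \<ge> k and m \<ge> k - 1. For integral
  \<open>k\<close>, values outside are at most \<open>k - 1\<close>, so \<open>D k\<close> is a top
  set; on \<open>D (k - 1) - D k\<close> only the values \<open>k - 2\<close> and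
  \<open>k - 1\<close> occur.\<close>

lemma tight_top_chain_of_separating_family:
  fixes m :: "'a \<Rightarrow> real"
  assumes "finite S" and ints: "m ` S \<subseteq> \<int>"
    and D_tight: "\<And>k. k \<in> \<int> \<Longrightarrow> tight p m (D k)" and D_sub: "\<And>k. D k \<subseteq> S"
    and D_lower: "\<And>k v. v \<in> S \<Longrightarrow> k \<le> m v \<Longrightarrow> v \<in> D k"
    and D_upper: "\<And>k v. v \<in> D k \<Longrightarrow> k - 1 \<le> m v"
    and D_antimono: "\<And>k k'. k \<le> k' \<Longrightarrow> D k' \<subseteq> D k"
    and D_empty: "\<And>k. (\<And>v. v \<in> S \<Longrightarrow> m v < k) \<Longrightarrow> D k = {}"
  shows "has_tight_top_chain S p m"
proof -
  obtain N :: nat where N: "\<And>v. v \<in> S \<Longrightarrow> \<bar>m v\<bar> < real N"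
  proof -
    obtain N :: nat where N: "(\<Sum>v\<in>S. \<bar>m v\<bar>) < real N"
      using reals_Archimedean2 by blast
    have "\<bar>m v\<bar> < real N" if "v \<in> S" for v
      using member_le_sum[OF that, of "\<lambda>v. \<bar>m v\<bar>"] N assms(1) by simp
    then show ?thesis by (rule that)
  qed
  \<comment> \<open>The threshold falls by one from \<open>N\<close>, above all values, to
    \<open>- N\<close>, below all of them; hence the ends are \<open>{}\<close> and
    \<open>S\<close>.\<close>
  define E where "E i = D (real N - real i)" for i
  have E0: "E 0 = {}"
    unfolding E_def by (rule D_empty) (use N in fastforce)
  have E2: "E (2 * N) = S"
  proof
    show "S \<subseteq> E (2 * N)"
    proof
      fix v assume "v \<in> S"
      with N[OF this] show "v \<in> E (2 * N)"
        unfolding E_def by (intro D_lower) auto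
    qed
  qed (simp add: E_def D_sub)
  define Q where "Q X Y \<longleftrightarrow> X \<subset> Y \<and> top_set S m Y \<and> tight p m Y \<and>
      near_uniform (Y - X) (restrict m (Y - X))" for X Y
  have "E i = E (Suc i) \<or> Q (E i) (E (Suc i))" for i
  proof (cases "E i = E (Suc i)")
    case False
    have "E i \<subseteq> E (Suc i)"
      unfolding E_def by (rule D_antimono) simp
    with False have strict: "E i \<subset> E (Suc i)" by blast
    have top: "top_set S m (E (Suc i))"
      unfolding top_set_def
    proof (intro conjI ballI)
      fix u v assume u: "u \<in> E (Suc i)" and v: "v \<in> S - E (Suc i)"
      have "m v \<in> \<int>" using v ints by blast
      moreover have "m v < real N - real (Suc i)"
        using v D_lower[of v "real N - real (Suc i)"] by (force simp: E_def)
      ultimately have "m v \<le> real N - real (Suc i) - 1"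
        by (intro Ints_less_imp_le_diff_one) simp_all
      also have "\<dots> \<le> m u"
        using u D_upper unfolding E_def by blast
      finally show "m v \<le> m u" .
    qed (simp add: E_def D_sub)
    have T: "finite (E (Suc i) - E i)" "E (Suc i) - E i \<noteq> {}" "E (Suc i) - E i \<subseteq> S"
      using strict D_sub[of "real N - real (Suc i)"] finite_subset[OF _ assms(1)]
      unfolding E_def by auto
    have bounds: "real N - real i - 2 \<le> m u \<and> m u \<le> real N - real i - 1"
      if u: "u \<in> E (Suc i) - E i" for u
    proof
      have "u \<in> D (real N - real (Suc i))"
        using u by (simp add: E_def)
      from D_upper[OF this] show "real N - real i - 2 \<le> m u"
        by simp
      have "u \<in> S" using u T by blast
      then have "m u \<in> \<int>" using ints by blast
      moreover have "m u < real N - real i"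
        using u D_lower[OF \<open>u \<in> S\<close>, of "real N - real i"] by (force simp: E_def)
      ultimately show "m u \<le> real N - real i - 1"
        by (intro Ints_less_imp_le_diff_one) simp_all
    qed
    have "near_uniform (E (Suc i) - E i) (restrict m (E (Suc i) - E i))"
      unfolding near_uniform_restrict_iff[OF T(1,2)]
    proof (intro conjI ballI)
      show "m ` (E (Suc i) - E i) \<subseteq> \<int>" using T(3) ints by blast
      show "m u - m v \<le> 1" if "u \<in> E (Suc i) - E i" "v \<in> E (Suc i) - E i" for u v
        using bounds[OF that(1)] bounds[OF that(2)] by linarith
    qed
    moreover have "tight p m (E (Suc i))"
      unfolding E_def by (rule D_tight) simp
    ultimately show ?thesis
      using strict top by (simp add: Q_def)
  qed simp
  from strict_chain_of_weak_chain[of "2 * N" E Q, OF this] show ?thesis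
    unfolding has_tight_top_chain_def E0 E2 Q_def by blast
qed

lemma no_tightening_step_imp_chain:
  fixes m :: "'a \<Rightarrow> real"
  assumes "finite S" and "int_valued S b" and "submodular S b" and "b {} = 0"
    and m: "m \<in> base_polyhedron S b \<inter> int_vecs S"
    and "no_tightening_step S (base_polyhedron S b) m"
  shows "has_tight_top_chain S (complementary S b) m"
proof -
  have ints: "m ` S \<subseteq> \<int>"
    using m by (auto simp: int_vecs_def)
  have sumS: "ereal (sum m S) = b S" and le: "\<And>Z. Z \<subseteq> S \<Longrightarrow> ereal (sum m Z) \<le> b Z"
    using m by (auto simp: base_polyhedron_def)
  define F where "F = {X. X \<subseteq> S \<and> tight (complementary S b) m X}"
  have F_iff: "X \<in> F \<longleftrightarrow> X \<subseteq> S \<and> tight b m (S - X)" for X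
    using tight_complementary_iff[of S _ m b] assms(1) sumS by (auto simp: F_def)
  have F_Int: "X \<inter> Y \<in> F" and F_Un: "X \<union> Y \<in> F" if "X \<in> F" "Y \<in> F" for X Y
    using tight_Int_Un[OF assms(1,3) le, of "S - X" "S - Y"] that
    by (auto simp: F_iff Diff_Int Diff_Un)
  \<comment> \<open>Under complementation, \<open>S\<close> corresponds to \<open>b {} = 0\<close>
    and \<open>{}\<close> to the total being \<open>b S\<close>.\<close>
  have F_S: "S \<in> F" and F_empty: "{} \<in> F"
    using sumS assms(4) by (auto simp: F_iff tight_def zero_ereal_def)
  have sep: "\<exists>X\<in>F. t \<in> X \<and> s \<notin> X" if st: "s \<in> S" "t \<in> S" "m s + 2 \<le> m t" for s t
  proof -
    have "(\<lambda>v\<in>S. m v + indicator {s} v - indicator {t} v) \<notin> base_polyhedron S b" "s \<noteq> t"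
      using assms(6) that by (auto simp: no_tightening_step_def)
    then obtain Z where "Z \<subseteq> S" "tight b m Z" "s \<in> Z" "t \<notin> Z"
      using blocked_step_tight[OF assms(1,2) m st(1,2)] by metis
    then show ?thesis
      using that by (intro bexI[of _ "S - Z"]) (auto simp: F_iff double_diff)
  qed
  have "\<exists>X\<in>F. t \<in> X \<and> (\<forall>s\<in>X. m t - 1 \<le> m s)" if t: "t \<in> S" for t
  proof -
    \<comment> \<open>Starting from \<open>S\<close>, intersect with one separating tight set for
      each element to be avoided.\<close>
    have "\<exists>X\<in>F. t \<in> X \<and> X \<inter> A = {}" if "finite A" "A \<subseteq> {s \<in> S. m s + 2 \<le> m t}" for A
      using that
    proof (induction A)
      case empty
      then show ?case using F_S t by auto
    next
      case (insert s A)
      then obtain X where "X \<in> F" "t \<in> X" "X \<inter> A = {}" by auto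
      moreover obtain Y where "Y \<in> F" "t \<in> Y" "s \<notin> Y"
        using sep[of s t] insert.prems t by auto
      ultimately show ?case
        using F_Int by (intro bexI[of _ "X \<inter> Y"]) auto
    qed
    from this[of "{s \<in> S. m s + 2 \<le> m t}"] obtain X
      where X: "X \<in> F" "t \<in> X" "X \<inter> {s \<in> S. m s + 2 \<le> m t} = {}"
      using assms(1) by auto
    have "m t - 1 \<le> m s" if "s \<in> X" for s
    proof -
      have "s \<in> S" using that X(1) by (auto simp: F_def)
      then have "m s \<in> \<int>" "m t \<in> \<int>" using ints t by auto
      moreover have "m t < m s + 2" using X(3) that \<open>s \<in> S\<close> by force
      ultimately show ?thesis
        using Ints_less_imp_le_diff_one[of "m t" "m s + 2"] by simp
    qed
    then show ?thesis using X by blast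
  qed
  then obtain X where XF: "\<And>t. t \<in> S \<Longrightarrow> X t \<in> F" and tX: "\<And>t. t \<in> S \<Longrightarrow> t \<in> X t"
    and Xm: "\<And>t s. t \<in> S \<Longrightarrow> s \<in> X t \<Longrightarrow> m t - 1 \<le> m s"
    by metis
  \<comment> \<open>Each \<open>X t\<close> contains \<open>t\<close> and dips at most 1 below
    \<open>m t\<close>, so the union covers all values from \<open>k\<close> up and reaches no lower
    than \<open>k - 1\<close>.\<close>
  define D where "D k = (\<Union>t\<in>{t \<in> S. k \<le> m t}. X t)" for k
  have "(\<Union>t\<in>A. X t) \<in> F" if "finite A" "A \<subseteq> S" for A
    using that by (induction A) (auto simp: F_empty intro!: F_Un XF)
  then have DF: "D k \<in> F" for k
    using assms(1) by (simp add: D_def)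
  show ?thesis
  proof (rule tight_top_chain_of_separating_family[where D = D, OF assms(1) ints])
    show "tight (complementary S b) m (D k)" "D k \<subseteq> S" for k
      using DF by (auto simp: F_def)
    show "v \<in> D k" if "v \<in> S" "k \<le> m v" for k v
      using that tX by (auto simp: D_def)
    show "k - 1 \<le> m v" if "v \<in> D k" for k v
      using that Xm by (force simp: D_def)
    show "D k' \<subseteq> D k" if "k \<le> k'" for k k'
      using that by (force simp: D_def)
    show "D k = {}" if "\<And>v. v \<in> S \<Longrightarrow> m v < k" for k
      using that by (force simp: D_def)
  qed
qed

section \<open>Equivalence of the four conditions\<close>

theorem theorem3p3:
  fixes S :: "'a set" and b p :: "'a set \<Rightarrow> ereal" and B :: "('a \<Rightarrow> real) set"
    and m :: "'a \<Rightarrow> real"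
  assumes "finite S" and "S \<noteq> {}"
    and "int_valued S b" and "submodular S b"
    and "b {} = 0" and "\<bar>b S\<bar> \<noteq> \<infinity>"
    and "p = complementary S b"
    and "B = base_polyhedron S b"
    and "m \<in> B \<inter> int_vecs S"
  shows "(no_tightening_step S B m \<longleftrightarrow> has_tight_top_chain S p m) \<and>
    (has_tight_top_chain S p m \<longleftrightarrow> dec_min S (B \<inter> int_vecs S) m) \<and>
    (dec_min S (B \<inter> int_vecs S) m \<longleftrightarrow> inc_max S (B \<inter> int_vecs S) m)"
proof -
  have ints: "x ` S \<subseteq> \<int>" if "x \<in> int_vecs S" for x
    using that by (auto simp: int_vecs_def)
  have AB: "has_tight_top_chain S p m" if "no_tightening_step S B m"
    using no_tightening_step_imp_chain[of S b m] assms that by simp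
  have BC: "dec_min S (B \<inter> int_vecs S) m \<and> inc_max S (B \<inter> int_vecs S) m"
    if chain: "has_tight_top_chain S p m"
  proof -
    have "tight p m {}"
      using assms(6) by (simp add: assms(7) tight_def complementary_def zero_ereal_def)
    have maj: "(\<Sum>v\<in>S. max 0 (m v - k)) \<le> (\<Sum>v\<in>S. max 0 (y v - k))"
      if "y \<in> B" "k \<in> \<int>" for y k
    proof (rule tight_top_chain_majorizes[OF assms(1) _ \<open>k \<in> \<int>\<close> chain \<open>tight p m {}\<close>])
      show "m ` S \<subseteq> \<int>" using assms(9) ints by blast
      show "p Z \<le> ereal (sum y Z)" if "Z \<subseteq> S" for Z
        using \<open>y \<in> B\<close> that
        unfolding assms(7,8) base_polyhedron_complementary[OF assms(1,5,6)] by blast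
    qed
    \<comment> \<open>The common total \<open>b S\<close> lets excess domination yield shortfall
      domination.\<close>
    have "sum m S = sum y S" if "y \<in> B" for y
    proof -
      have "ereal (sum m S) = ereal (sum y S)"
        using that assms(9) by (simp add: assms(8) base_polyhedron_def)
      then show ?thesis by simp
    qed
    then have maj': "(\<Sum>v\<in>S. max 0 (k - m v)) \<le> (\<Sum>v\<in>S. max 0 (k - y v))"
      if "y \<in> B" "k \<in> \<int>" for y k
      using maj[OF that] that by (simp add: sum_shortfall_eq sum_subtractf)
    have "decr_sort S m \<le> decr_sort S y \<and> incr_sort S y \<le> incr_sort S m"
      if y: "y \<in> B \<inter> int_vecs S" for y
    proof
      have ints_my: "m ` S \<subseteq> \<int>" "y ` S \<subseteq> \<int>" and "y \<in> B"
        using y assms(9) ints by blast+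
      show "decr_sort S m \<le> decr_sort S y"
        by (rule decr_sort_le_of_majorized[OF assms(1) ints_my maj[OF \<open>y \<in> B\<close>]])
      show "incr_sort S y \<le> incr_sort S m"
        by (rule incr_sort_ge_of_majorized[OF assms(1) ints_my maj'[OF \<open>y \<in> B\<close>]])
    qed
    then show ?thesis
      using assms(9) by (auto simp: dec_min_def inc_max_def)
  qed
  \<comment> \<open>Either optimality alone suffices, since a step preserves integrality and
    strictly improves both sorted vectors. With \<open>AB\<close> and \<open>BC\<close> this closes
    the cycle.\<close>
  have CA: "no_tightening_step S B m"
    if "dec_min S (B \<inter> int_vecs S) m \<or> inc_max S (B \<inter> int_vecs S) m"
    unfolding no_tightening_step_def
  proof safe
    fix s t
    let ?y = "\<lambda>v\<in>S. m v + indicator {s} v - indicator {t} v"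
    assume st: "s \<in> S" "t \<in> S" "m s + 2 \<le> m t" and "?y \<in> B"
    have "?y \<in> int_vecs S"
      using assms(9) by (auto simp: int_vecs_def indicator_def)
    then have "?y \<in> B \<inter> int_vecs S" using \<open>?y \<in> B\<close> by blast
    then have "decr_sort S m \<le> decr_sort S ?y \<or> incr_sort S ?y \<le> incr_sort S m"
      using that unfolding dec_min_def inc_max_def by blast
    then show False
      using tightening_step_sorts[OF assms(1) st] by (auto simp: not_le[symmetric])
  qed
  show ?thesis
    using AB BC CA by blast
qed

end
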